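(* For any $\beta>0$, define $\boldsymbol\lambda^\star\in\mathbb R^M_+$ as a solution of $$\min_{\boldsymbol\lambda\ge0}\Big\{F(\boldsymbol\lambda):=\mathbb E_{\mathbf X}\big[\mathrm{LSE}_\beta\big(-\mathbf L(\mathbf X)-\mathbf C(\mathbf X)^\top\boldsymbol\lambda\big)\big]\Big\}.$$ Assume that there exists a randomized prediction function $\boldsymbol\pi$ such that $\mathbb E[\mathbf C(\mathbf X)\boldsymbol\pi(\mathbf X)]<0$ (componentwise). Then the problem $$\min_{\boldsymbol\pi}\big\{\mathcal R_\beta(\boldsymbol\pi)\;:\;\mathcal C_j(\boldsymbol\pi)\le0\ \ \forall j\in[M]\big\},$$ the minimum being over all randomized prediction functions, admits a solution of the form $$\pi_{\boldsymbol\lambda^\star}(a\mid\mathbf x)\propto\exp\Big(\beta\big(-\mathbf L(\mathbf x)-\mathbf C(\mathbf x)^\top\boldsymbol\lambda^\star\big)_a\Big)\quad\text{for }a\in\mathcal A.$$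
   Context: Setting. $\mathcal X$ is a feature space, $\mathbf X\sim\mathbb P_{\mathbf X}$ is a random element of $\mathcal X$, $\mathcal A$ is a finite set of predictions, $M\ge0$ an integer, $[M]=\{1,\dots,M\}$. There are (measurable) functions $\ell:\mathcal X\times\mathcal A\to\mathbb R$ (loss) and $c_j:\mathcal X\times\mathcal A\to\mathbb R$, $j\in[M]$ (costs). Put $\mathbf L(\mathbf x)=(\ell(\mathbf x,a))_{a\in\mathcal A}\in\mathbb R^{|\mathcal A|}$ and $\mathbf C(\mathbf x)=(c_j(\mathbf x,a))_{j\in[M],a\in\mathcal A}\in\mathbb R^{M\times|\mathcal A|}$, and assume $\mathbb E\|\mathbf L(\mathbf X)\|<\infty$, $\mathbb E\|\mathbf C(\mathbf X)\|_{2\to2}<\infty$ (Euclidean norm and Euclidean operator norm). A randomized prediction function is a Markov kernel $\pi$ from $\mathcal X$ to $\mathcal A$, identified with $\boldsymbol\pi(\mathbf x)=(\pi(a\mid\mathbf x))_{a\in\mathcal A}$. Its risk and costs are $\mathcal R(\boldsymbol\pi)=\mathbb E_{\mathbf X}[\sum_{a}\ell(\mathbf X,a)\pi(a\mid\mathbf X)]$ and $\mathcal C_j(\boldsymbol\pi)=\mathbb E_{\mathbf X}[\sum_a c_j(\mathbf X,a)\pi(a\mid\mathbf X)]$, and its entropic-regularized risk is $\mathcal R_\beta(\boldsymbol\pi)=\mathcal R(\boldsymbol\pi)+\frac1\beta\mathbb E\big[\sum_{a\in\mathcal A}\pi(a\mid\mathbf X)\log\pi(a\mid\mathbf X)\big]$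 (with $0\log0=0$). For $\mathbf w\in\mathbb R^m$, $\mathrm{LSE}_\beta(\mathbf w)=\beta^{-1}\log(\sum_{j=1}^m e^{\beta w_j})$. The symbol $\propto$ means normalized to sum to one over $\mathcal A$. *)

theory Defs
  imports "HOL-Probability.Probability"
begin

text \<open>
  Vectors in \<open>\<real>\<^sup>m\<close> are functions of an index from a finite set, so that the number of
  constraints \<open>M\<close> may be any natural number, including 0; their Euclidean norm is
  \<^const>\<open>L2_set\<close>.  A member \<open>lam\<close> of the nonnegative orthant of \<open>\<real>\<^sup>M\<close> is an extensional
  function in \<open>{1..M} \<rightarrow>\<^sub>E {0..}\<close>.
\<close>

definition op_norm_2_2 :: "nat \<Rightarrow> 'a set \<Rightarrow> (nat \<Rightarrow> 'a \<Rightarrow> real) \<Rightarrow> real" where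
  "op_norm_2_2 M A B =
     (SUP v\<in>{v. L2_set v A \<le> 1}. L2_set (\<lambda>j. \<Sum>a\<in>A. B j a * v a) {1..M})"

definition LSE :: "real \<Rightarrow> 'i set \<Rightarrow> ('i \<Rightarrow> real) \<Rightarrow> real" where
  "LSE \<beta> I w = (1 / \<beta>) * ln (\<Sum>i\<in>I. exp (\<beta> * w i))"

definition randomized_predictions :: "'x measure \<Rightarrow> 'a set \<Rightarrow> ('x \<Rightarrow> 'a measure) set" where
  "randomized_predictions PX A = PX \<rightarrow>\<^sub>M prob_algebra (count_space A)"

text \<open>\<open>pred_prob \<pi> a x\<close> is \<open>\<pi>(a | x)\<close>.\<close>

definition pred_prob :: "('x \<Rightarrow> 'a measure) \<Rightarrow> 'a \<Rightarrow> 'x \<Rightarrow> real" where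
  "pred_prob \<pi> a x = measure (\<pi> x) {a}"

text \<open>The risk is \<open>mean_value PX A loss \<pi>\<close>, and the \<open>j\<close>-th cost is \<open>mean_value PX A (c j) \<pi>\<close>.\<close>

definition mean_value ::
  "'x measure \<Rightarrow> 'a set \<Rightarrow> ('x \<Rightarrow> 'a \<Rightarrow> real) \<Rightarrow> ('x \<Rightarrow> 'a measure) \<Rightarrow> real" where
  "mean_value PX A g \<pi> = (\<integral>x. (\<Sum>a\<in>A. g x a * pred_prob \<pi> a x) \<partial>PX)"

text \<open>The convention \<open>0 log 0 = 0\<close> holds since the factor 0 annihilates the value of \<open>ln 0\<close>.\<close>

definition entropic_risk ::
  "'x measure \<Rightarrow> 'a set \<Rightarrow> ('x \<Rightarrow> 'a \<Rightarrow> real) \<Rightarrow> real \<Rightarrow> ('x \<Rightarrow> 'a measure) \<Rightarrow> real" where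
  "entropic_risk PX A loss \<beta> \<pi> =
     mean_value PX A loss \<pi>
     + (1 / \<beta>) * (\<integral>x. (\<Sum>a\<in>A. pred_prob \<pi> a x * ln (pred_prob \<pi> a x)) \<partial>PX)"

text \<open>The vector \<open>- L(x) - C(x)\<^sup>T \<lambda>\<close>, indexed by the predictions.\<close>

definition score ::
  "nat \<Rightarrow> ('x \<Rightarrow> 'a \<Rightarrow> real) \<Rightarrow> (nat \<Rightarrow> 'x \<Rightarrow> 'a \<Rightarrow> real) \<Rightarrow> (nat \<Rightarrow> real) \<Rightarrow> 'x \<Rightarrow> 'a \<Rightarrow> real" where
  "score M loss c lam x a = - loss x a - (\<Sum>j\<in>{1..M}. c j x a * lam j)"

definition dual_objective ::
  "'x measure \<Rightarrow> 'a set \<Rightarrow> nat \<Rightarrow> ('x \<Rightarrow> 'a \<Rightarrow> real) \<Rightarrow> (nat \<Rightarrow> 'x \<Rightarrow> 'a \<Rightarrow> real) \<Rightarrow> real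
     \<Rightarrow> (nat \<Rightarrow> real) \<Rightarrow> real" where
  "dual_objective PX A M loss c \<beta> lam = (\<integral>x. LSE \<beta> A (score M loss c lam x) \<partial>PX)"

definition dual_solution ::
  "'x measure \<Rightarrow> 'a set \<Rightarrow> nat \<Rightarrow> ('x \<Rightarrow> 'a \<Rightarrow> real) \<Rightarrow> (nat \<Rightarrow> 'x \<Rightarrow> 'a \<Rightarrow> real) \<Rightarrow> real
     \<Rightarrow> (nat \<Rightarrow> real) \<Rightarrow> bool" where
  "dual_solution PX A M loss c \<beta> lam \<longleftrightarrow>
     is_arg_min (dual_objective PX A M loss c \<beta>) (\<lambda>l. l \<in> {1..M} \<rightarrow>\<^sub>E {0..}) lam"

definition primal_solution ::
  "'x measure \<Rightarrow> 'a set \<Rightarrow> nat \<Rightarrow> ('x \<Rightarrow> 'a \<Rightarrow> real) \<Rightarrow> (nat \<Rightarrow> 'x \<Rightarrow> 'a \<Rightarrow> real) \<Rightarrow> real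
     \<Rightarrow> ('x \<Rightarrow> 'a measure) \<Rightarrow> bool" where
  "primal_solution PX A M loss c \<beta> \<pi> \<longleftrightarrow>
     is_arg_min (entropic_risk PX A loss \<beta>)
       (\<lambda>p. p \<in> randomized_predictions PX A \<and> (\<forall>j\<in>{1..M}. mean_value PX A (c j) p \<le> 0)) \<pi>"

end

theory Submission
  imports Defs
begin

text \<open>
  Write \<open>F\<close> for the dual objective and \<open>\<pi>\<^sub>\<lambda>\<close> for the kernel with weights
  proportional to \<open>exp (\<beta> * score)\<close>.  The theorem is Lagrangian duality for a problem in which
  the inner minimization is explicit.  Pointwise in \<open>x\<close>, the Gibbs variational principle says
  that, among all probability vectors \<open>p\<close>, the quantity
  \<open>\<Sum>a. p a * w a - (1 / \<beta>) * (\<Sum>a. p a * ln (p a))\<close> has the maximum \<open>LSE \<beta> A w\<close>, attained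
  at the softmax of \<open>w\<close> (\<open>regularized_gain_le_LSE\<close>, \<open>regularized_gain_softmax\<close>).  Taking
  \<open>w\<close> to be the score and integrating, the Lagrangian \<open>risk + \<Sum>j. \<lambda> j * cost j\<close> has the minimum
  \<open>- F \<lambda>\<close> over all kernels, attained at \<open>\<pi>\<^sub>\<lambda>\<close> (\<open>weak_duality\<close>, \<open>lagrangian_gibbs\<close>).

  Comparing the Lagrangians at two multipliers gives, without differentiating under the integral,
  \<open>F \<mu> - F \<lambda> \<le> (\<Sum>j. (\<lambda> j - \<mu> j) * cost j \<pi>\<^sub>\<mu>)\<close> (\<open>dual_value_diff_le\<close>).  This one inequality
  is used twice.  It shows that \<open>F\<close> is Lipschitz; as a strictly feasible kernel makes \<open>F\<close>
  grow at least linearly on the orthant (\<open>dual_value_coercive\<close>), \<open>F\<close> has a minimizer.  And at a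
  minimizer \<open>\<lambda>\<close>, applied to \<open>\<mu>\<close> tending to \<open>\<lambda>\<close> along one coordinate, it yields that
  \<open>\<pi>\<^sub>\<lambda>\<close> satisfies the constraints and complementary slackness
  (\<open>dual_solution_feasible\<close>, \<open>dual_solution_complementary\<close>).  Hence the
  Lagrangian of \<open>\<pi>\<^sub>\<lambda>\<close> is its risk, while the Lagrangian of any other feasible kernel
  is at most its risk, so \<open>\<pi>\<^sub>\<lambda>\<close> is optimal.
\<close>

section \<open>The Gibbs variational principle\<close>

definition softmax :: "real \<Rightarrow> 'i set \<Rightarrow> ('i \<Rightarrow> real) \<Rightarrow> 'i \<Rightarrow> real" where
  "softmax \<beta> I w i = exp (\<beta> * w i) / (\<Sum>k\<in>I. exp (\<beta> * w k))"

definition regularized_gain ::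
  "real \<Rightarrow> 'i set \<Rightarrow> ('i \<Rightarrow> real) \<Rightarrow> ('i \<Rightarrow> real) \<Rightarrow> real" where
  "regularized_gain \<beta> I w p = (\<Sum>i\<in>I. w i * p i) - (1 / \<beta>) * (\<Sum>i\<in>I. p i * ln (p i))"

lemma sum_exp_pos:
  fixes w :: "'i \<Rightarrow> real"
  assumes "finite I" "I \<noteq> {}"
  shows "0 < (\<Sum>i\<in>I. exp (\<beta> * w i))"
  using assms by (intro sum_pos) auto

lemma softmax_pos: "finite I \<Longrightarrow> I \<noteq> {} \<Longrightarrow> 0 < softmax \<beta> I w i"
  unfolding softmax_def by (intro divide_pos_pos sum_exp_pos) auto

lemma sum_softmax: "finite I \<Longrightarrow> I \<noteq> {} \<Longrightarrow> (\<Sum>i\<in>I. softmax \<beta> I w i) = 1"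
  using sum_exp_pos[of I \<beta> w] by (simp add: softmax_def flip: sum_divide_distrib)

lemma softmax_le_1:
  assumes "finite I" "i \<in> I"
  shows "softmax \<beta> I w i \<le> 1"
proof -
  have "softmax \<beta> I w i \<le> (\<Sum>k\<in>I. softmax \<beta> I w k)"
    using assms by (intro member_le_sum) (auto intro: less_imp_le softmax_pos)
  also have "\<dots> = 1" using assms by (intro sum_softmax) auto
  finally show ?thesis .
qed

text \<open>
  The tangent bound \<open>ln t \<le> t - 1\<close> at \<open>t = softmax \<beta> I w i / p i\<close>, averaged over \<open>p\<close>: this is
  the nonnegativity of the relative entropy of \<open>p\<close> with respect to the softmax.
\<close>

lemma regularized_gain_le_LSE:
  fixes w p :: "'i \<Rightarrow> real"
  assumes fin: "finite I" "I \<noteq> {}" and "\<beta> > 0"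
    and p: "\<And>i. i \<in> I \<Longrightarrow> 0 \<le> p i" "(\<Sum>i\<in>I. p i) = 1"
  shows "regularized_gain \<beta> I w p \<le> LSE \<beta> I w"
proof -
  define Z where "Z = (\<Sum>i\<in>I. exp (\<beta> * w i))"
  have Z: "Z > 0" unfolding Z_def using fin by (rule sum_exp_pos)
  have "p i * (\<beta> * w i - ln (p i)) \<le> exp (\<beta> * w i) / Z - p i + p i * ln Z" if "i \<in> I" for i
  proof (cases "p i = 0")
    case True
    then show ?thesis using Z by simp
  next
    case False
    with p(1)[OF that] have pi: "p i > 0" by simp
    have "ln (exp (\<beta> * w i) / (Z * p i)) \<le> exp (\<beta> * w i) / (Z * p i) - 1"
      using pi Z by (intro ln_le_minus_one) simp
    also have "ln (exp (\<beta> * w i) / (Z * p i)) = \<beta> * w i - ln Z - ln (p i)"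
      using pi Z by (simp add: ln_div ln_mult)
    finally have "p i * (\<beta> * w i - ln Z - ln (p i)) \<le> p i * (exp (\<beta> * w i) / (Z * p i) - 1)"
      using pi by (intro mult_left_mono) auto
    also have "\<dots> = exp (\<beta> * w i) / Z - p i" using pi Z by (simp add: field_simps)
    finally show ?thesis by (simp add: algebra_simps)
  qed
  then have "(\<Sum>i\<in>I. p i * (\<beta> * w i - ln (p i)))
      \<le> (\<Sum>i\<in>I. exp (\<beta> * w i) / Z - p i + p i * ln Z)"
    by (rule sum_mono)
  also have "\<dots> = (\<Sum>i\<in>I. exp (\<beta> * w i)) / Z - 1 + ln Z"
    using p(2) by (simp add: sum.distrib sum_subtractf flip: sum_divide_distrib sum_distrib_right)
  also have "\<dots> = ln Z" using Z by (simp add: Z_def)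
  also have "(\<Sum>i\<in>I. p i * (\<beta> * w i - ln (p i)))
      = \<beta> * (\<Sum>i\<in>I. w i * p i) - (\<Sum>i\<in>I. p i * ln (p i))"
    by (simp add: sum_subtractf sum_distrib_left algebra_simps)
  finally have "(\<beta> * (\<Sum>i\<in>I. w i * p i) - (\<Sum>i\<in>I. p i * ln (p i))) / \<beta> \<le> ln Z / \<beta>"
    using \<open>\<beta> > 0\<close> by (intro divide_right_mono) auto
  then show ?thesis
    using \<open>\<beta> > 0\<close> by (simp add: regularized_gain_def LSE_def Z_def diff_divide_distrib)
qed

lemma regularized_gain_softmax:
  assumes fin: "finite I" "I \<noteq> {}" and "\<beta> > 0"
  shows "regularized_gain \<beta> I w (softmax \<beta> I w) = LSE \<beta> I w"
proof -
  let ?q = "softmax \<beta> I w" and ?Z = "\<Sum>i\<in>I. exp (\<beta> * w i)"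
  have ln_q: "ln (?q i) = \<beta> * w i - ln ?Z" for i
    using sum_exp_pos[OF fin, of \<beta> w] by (simp add: softmax_def ln_div)
  have "(\<Sum>i\<in>I. ?q i * ln (?q i)) = \<beta> * (\<Sum>i\<in>I. w i * ?q i) - (\<Sum>i\<in>I. ?q i) * ln ?Z"
    unfolding ln_q by (simp add: sum_subtractf sum_distrib_left sum_distrib_right algebra_simps)
  then show ?thesis
    using \<open>\<beta> > 0\<close> by (simp add: regularized_gain_def LSE_def sum_softmax[OF fin] field_simps)
qed

text \<open>Bounds the entropy integrand, so that it is integrable over a probability space.\<close>

lemma abs_mult_ln_le_1:
  fixes p :: real
  assumes "0 \<le> p" "p \<le> 1"
  shows "\<bar>p * ln p\<bar> \<le> 1"
proof (cases "p = 0")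
  case False
  with assms have p: "p > 0" by simp
  have "- ln p \<le> 1 / p - 1" using ln_le_minus_one[of "1 / p"] p by (simp add: ln_div)
  then have "p * (- ln p) \<le> p * (1 / p - 1)" using p by (intro mult_left_mono) auto
  also have "\<dots> \<le> 1" using p by (simp add: field_simps)
  finally have "- (p * ln p) \<le> 1" by simp
  moreover have "p * ln p \<le> 0" using p assms by (simp add: mult_nonneg_nonpos)
  ultimately show ?thesis by simp
qed simp

section \<open>Norms bound entries\<close>

text \<open>
  The boundedness of the set is part of the argument, since a supremum of reals says nothing
  about its members otherwise; the entry is then reached at the unit vector of its column.
\<close>

lemma abs_entry_le_op_norm_2_2:
  assumes A: "finite A" "a \<in> A" and j: "j \<in> {1..M}"
  shows "\<bar>B j a\<bar> \<le> op_norm_2_2 M A B"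
proof -
  let ?f = "\<lambda>v. L2_set (\<lambda>j. \<Sum>a\<in>A. B j a * v a) {1..M}"
  have "?f v \<le> (\<Sum>j\<in>{1..M}. \<Sum>a\<in>A. \<bar>B j a\<bar>)" if "L2_set v A \<le> 1" for v
  proof -
    have v: "\<bar>v a\<bar> \<le> 1" if "a \<in> A" for a
    proof -
      have "\<bar>v a\<bar> \<le> L2_set (\<lambda>a. \<bar>v a\<bar>) A" using A that by (intro member_le_L2_set)
      also have "\<dots> = L2_set v A" by (simp add: L2_set_def)
      finally show ?thesis using \<open>L2_set v A \<le> 1\<close> by simp
    qed
    have "?f v \<le> (\<Sum>j\<in>{1..M}. \<bar>\<Sum>a\<in>A. B j a * v a\<bar>)" by (rule L2_set_le_sum_abs)
    also have "\<dots> \<le> (\<Sum>j\<in>{1..M}. \<Sum>a\<in>A. \<bar>B j a\<bar>)"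
      using v by (intro sum_mono order.trans[OF sum_abs]) (auto simp: abs_mult mult_left_le)
    finally show ?thesis .
  qed
  then have bdd: "bdd_above (?f ` {v. L2_set v A \<le> 1})" by (intro bdd_aboveI2) auto
  let ?e = "\<lambda>b. if b = a then 1 else 0 :: real"
  have e: "L2_set ?e A \<le> 1" using A by (simp add: L2_set_def if_distrib[of "\<lambda>x. x\<^sup>2"] cong: if_cong)
  have "\<bar>B j a\<bar> \<le> L2_set (\<lambda>j. \<bar>B j a\<bar>) {1..M}" using j by (intro member_le_L2_set) auto
  also have "\<dots> = ?f ?e" using A by (simp add: L2_set_def if_distrib cong: if_cong)
  also have "\<dots> \<le> op_norm_2_2 M A B"
    unfolding op_norm_2_2_def using e by (intro cSUP_upper bdd) auto
  finally show ?thesis .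
qed

section \<open>Randomized predictions\<close>

lemma randomized_predictionsD:
  assumes "\<pi> \<in> randomized_predictions PX A" "finite A"
  shows "a \<in> A \<Longrightarrow> pred_prob \<pi> a \<in> borel_measurable PX"
    and "0 \<le> pred_prob \<pi> a x"
    and "x \<in> space PX \<Longrightarrow> pred_prob \<pi> a x \<le> 1"
    and "x \<in> space PX \<Longrightarrow> (\<Sum>a\<in>A. pred_prob \<pi> a x) = 1"
proof -
  have meas: "\<pi> \<in> PX \<rightarrow>\<^sub>M prob_algebra (count_space A)"
    using assms by (simp add: randomized_predictions_def)
  show "a \<in> A \<Longrightarrow> pred_prob \<pi> a \<in> borel_measurable PX"
    unfolding pred_prob_def using meas by measurable
  show "0 \<le> pred_prob \<pi> a x" by (simp add: pred_prob_def)
  assume "x \<in> space PX"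
  from measurable_space[OF meas this] have \<pi>: "sets (\<pi> x) = Pow A" "prob_space (\<pi> x)"
    by (auto simp: space_prob_algebra)
  interpret prob_space "\<pi> x" by fact
  have sp: "space (\<pi> x) = A" using sets_eq_imp_space_eq[of "\<pi> x" "count_space A"] \<pi> by simp
  show "pred_prob \<pi> a x \<le> 1" by (simp add: pred_prob_def)
  have "(\<Sum>a\<in>A. measure (\<pi> x) {a}) = measure (\<pi> x) A"
    using \<open>finite A\<close> \<pi> by (intro finite_measure_eq_sum_singleton[symmetric]) auto
  then show "(\<Sum>a\<in>A. pred_prob \<pi> a x) = 1"
    using prob_space sp by (simp add: pred_prob_def)
qed

definition kernel_of_weights :: "'a set \<Rightarrow> ('x \<Rightarrow> 'a \<Rightarrow> real) \<Rightarrow> 'x \<Rightarrow> 'a measure" where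
  "kernel_of_weights A q x = point_measure A (\<lambda>a. ennreal (q x a))"

lemma kernel_of_weights:
  assumes A: "finite A"
    and meas: "\<And>a. a \<in> A \<Longrightarrow> (\<lambda>x. q x a) \<in> borel_measurable PX"
    and nonneg: "\<And>x a. x \<in> space PX \<Longrightarrow> a \<in> A \<Longrightarrow> 0 \<le> q x a"
    and sum1: "\<And>x. x \<in> space PX \<Longrightarrow> (\<Sum>a\<in>A. q x a) = 1"
  shows "kernel_of_weights A q \<in> randomized_predictions PX A"
    and "x \<in> space PX \<Longrightarrow> a \<in> A \<Longrightarrow> pred_prob (kernel_of_weights A q) a x = q x a"
proof -
  have em: "emeasure (kernel_of_weights A q x) X = (\<Sum>a\<in>X. ennreal (q x a))" if "X \<subseteq> A" for x X
    using A that by (simp add: kernel_of_weights_def emeasure_point_measure_finite)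
  have prob: "prob_space (kernel_of_weights A q x)" if "x \<in> space PX" for x
  proof
    have "(\<Sum>a\<in>A. ennreal (q x a)) = 1" using nonneg sum1 that by simp
    then show "emeasure (kernel_of_weights A q x) (space (kernel_of_weights A q x)) = 1"
      using em[of A x] by (simp add: kernel_of_weights_def space_point_measure)
  qed
  have sub: "kernel_of_weights A q \<in> PX \<rightarrow>\<^sub>M subprob_algebra (count_space A)"
  proof (rule measurable_subprob_algebra)
    fix X assume "X \<in> sets (count_space A)"
    then have "X \<subseteq> A" by simp
    then show "(\<lambda>x. emeasure (kernel_of_weights A q x) X) \<in> borel_measurable PX"
      unfolding em[OF \<open>X \<subseteq> A\<close>] using meas
      by (intro borel_measurable_sum measurable_compose[OF _ measurable_ennreal]) auto
  next
    fix x assume "x \<in> space PX"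
    then show "subprob_space (kernel_of_weights A q x)"
      by (intro prob_space_imp_subprob_space prob)
  qed (simp add: kernel_of_weights_def sets_point_measure)
  show "kernel_of_weights A q \<in> randomized_predictions PX A"
    unfolding randomized_predictions_def using prob sub by (rule measurable_prob_algebraI)
  show "pred_prob (kernel_of_weights A q) a x = q x a" if "x \<in> space PX" "a \<in> A"
    using em[of "{a}" x] nonneg[OF that] that by (simp add: pred_prob_def measure_def)
qed

section \<open>Duality\<close>

text \<open>
  Only the single entries of the loss and of the cost matrix occur in the duality argument, so the
  moment conditions on the norms enter it as integrability of the entries.
\<close>

locale entropic_problem = prob_space PX for PX :: "'x measure" +
  fixes A :: "'a set" and M :: nat
    and loss :: "'x \<Rightarrow> 'a \<Rightarrow> real" and c :: "nat \<Rightarrow> 'x \<Rightarrow> 'a \<Rightarrow> real" and \<beta> :: real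
  assumes finite_A: "finite A" and A_nonempty: "A \<noteq> {}" and beta_pos: "\<beta> > 0"
    and integrable_loss: "a \<in> A \<Longrightarrow> integrable PX (\<lambda>x. loss x a)"
    and integrable_cost: "j \<in> {1..M} \<Longrightarrow> a \<in> A \<Longrightarrow> integrable PX (\<lambda>x. c j x a)"
begin

abbreviation "predictions \<equiv> randomized_predictions PX A"
abbreviation "cost j \<equiv> mean_value PX A (c j)"
abbreviation "risk \<equiv> entropic_risk PX A loss \<beta>"
abbreviation "dual_value \<equiv> dual_objective PX A M loss c \<beta>"
abbreviation "orthant \<equiv> {1..M} \<rightarrow>\<^sub>E {0::real..}"

definition lagrangian :: "('x \<Rightarrow> 'a measure) \<Rightarrow> (nat \<Rightarrow> real) \<Rightarrow> real" where
  "lagrangian \<pi> lam = risk \<pi> + (\<Sum>j\<in>{1..M}. lam j * cost j \<pi>)"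

definition gibbs :: "(nat \<Rightarrow> real) \<Rightarrow> 'x \<Rightarrow> 'a measure" where
  "gibbs lam = kernel_of_weights A (\<lambda>x. softmax \<beta> A (score M loss c lam x))"

lemma integrable_score:
  "a \<in> A \<Longrightarrow> integrable PX (\<lambda>x. score M loss c lam x a)"
  unfolding score_def
  by (rule Bochner_Integration.integrable_diff Bochner_Integration.integrable_minus
      Bochner_Integration.integrable_sum integrable_mult_left integrable_loss integrable_cost
      | assumption)+

lemma integrable_mean:
  assumes \<pi>: "\<pi> \<in> predictions" and g: "\<And>a. a \<in> A \<Longrightarrow> integrable PX (\<lambda>x. g x a)"
  shows "integrable PX (\<lambda>x. \<Sum>a\<in>A. g x a * pred_prob \<pi> a x)"
proof (rule Bochner_Integration.integrable_sum)
  note p = randomized_predictionsD[OF \<pi> finite_A]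
  fix a assume a: "a \<in> A"
  show "integrable PX (\<lambda>x. g x a * pred_prob \<pi> a x)"
  proof (rule Bochner_Integration.integrable_bound[OF g[OF a]])
    show "(\<lambda>x. g x a * pred_prob \<pi> a x) \<in> borel_measurable PX"
      using g[OF a] p(1)[OF a] by measurable
    show "AE x in PX. norm (g x a * pred_prob \<pi> a x) \<le> norm (g x a)"
      using p by (intro AE_I2) (simp add: abs_mult mult_left_le)
  qed
qed

lemma integrable_entropy:
  assumes \<pi>: "\<pi> \<in> predictions"
  shows "integrable PX (\<lambda>x. \<Sum>a\<in>A. pred_prob \<pi> a x * ln (pred_prob \<pi> a x))"
proof (rule Bochner_Integration.integrable_sum)
  note p = randomized_predictionsD[OF \<pi> finite_A]
  fix a assume a: "a \<in> A"
  show "integrable PX (\<lambda>x. pred_prob \<pi> a x * ln (pred_prob \<pi> a x))"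
  proof (rule integrable_const_bound[where B = 1])
    show "(\<lambda>x. pred_prob \<pi> a x * ln (pred_prob \<pi> a x)) \<in> borel_measurable PX"
      using p(1)[OF a] by measurable
    show "AE x in PX. norm (pred_prob \<pi> a x * ln (pred_prob \<pi> a x)) \<le> 1"
      using p abs_mult_ln_le_1 by (intro AE_I2) auto
  qed
qed

lemma integrable_regularized_gain:
  assumes "\<pi> \<in> predictions"
  shows "integrable PX
    (\<lambda>x. regularized_gain \<beta> A (score M loss c lam x) (\<lambda>a. pred_prob \<pi> a x))"
  unfolding regularized_gain_def
  using integrable_mean[OF assms integrable_score] integrable_entropy[OF assms] by auto

lemma lagrangian_eq_integral:
  assumes \<pi>: "\<pi> \<in> predictions"
  shows "lagrangian \<pi> lam =
    - (\<integral>x. regularized_gain \<beta> A (score M loss c lam x) (\<lambda>a. pred_prob \<pi> a x) \<partial>PX)"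
proof -
  let ?L = "\<lambda>x. \<Sum>a\<in>A. loss x a * pred_prob \<pi> a x"
  let ?C = "\<lambda>j x. \<Sum>a\<in>A. c j x a * pred_prob \<pi> a x"
  let ?H = "\<lambda>x. \<Sum>a\<in>A. pred_prob \<pi> a x * ln (pred_prob \<pi> a x)"
  have L: "integrable PX ?L" using \<pi> integrable_loss by (rule integrable_mean)
  have C: "integrable PX (?C j)" if "j \<in> {1..M}" for j
    using \<pi> integrable_cost[OF that] by (rule integrable_mean)
  note H = integrable_entropy[OF \<pi>]
  have "- regularized_gain \<beta> A (score M loss c lam x) (\<lambda>a. pred_prob \<pi> a x) =
      ?L x + (1 / \<beta>) * ?H x + (\<Sum>j\<in>{1..M}. lam j * ?C j x)" for x
  proof -
    have "(\<Sum>a\<in>A. score M loss c lam x a * pred_prob \<pi> a x) =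
        - ?L x - (\<Sum>a\<in>A. \<Sum>j\<in>{1..M}. lam j * (c j x a * pred_prob \<pi> a x))"
      by (simp add: score_def algebra_simps sum.distrib sum_negf sum_subtractf sum_distrib_left)
    also have "(\<Sum>a\<in>A. \<Sum>j\<in>{1..M}. lam j * (c j x a * pred_prob \<pi> a x)) =
        (\<Sum>j\<in>{1..M}. lam j * ?C j x)"
      by (subst sum.swap) (simp add: sum_distrib_left)
    finally show ?thesis by (simp add: regularized_gain_def)
  qed
  then have "- (\<integral>x. regularized_gain \<beta> A (score M loss c lam x) (\<lambda>a. pred_prob \<pi> a x) \<partial>PX) =
      (\<integral>x. ?L x + (1 / \<beta>) * ?H x + (\<Sum>j\<in>{1..M}. lam j * ?C j x) \<partial>PX)"
    by (simp flip: Bochner_Integration.integral_minus)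
  also have "\<dots> = (\<integral>x. ?L x + (1 / \<beta>) * ?H x \<partial>PX) + (\<integral>x. (\<Sum>j\<in>{1..M}. lam j * ?C j x) \<partial>PX)"
    using L H C by (intro Bochner_Integration.integral_add) auto
  also have "(\<integral>x. (\<Sum>j\<in>{1..M}. lam j * ?C j x) \<partial>PX) = (\<Sum>j\<in>{1..M}. lam j * cost j \<pi>)"
    using C by (subst Bochner_Integration.integral_sum) (auto simp: mean_value_def)
  also have "(\<integral>x. ?L x + (1 / \<beta>) * ?H x \<partial>PX) = risk \<pi>"
    using L H by (subst Bochner_Integration.integral_add) (auto simp: entropic_risk_def mean_value_def)
  finally show ?thesis by (simp add: lagrangian_def)
qed

lemma gibbs:
  shows gibbs_predictions: "gibbs lam \<in> predictions"
    and pred_prob_gibbs: "x \<in> space PX \<Longrightarrow> a \<in> A \<Longrightarrow>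
      pred_prob (gibbs lam) a x = softmax \<beta> A (score M loss c lam x) a"
proof -
  have s: "(\<lambda>x. score M loss c lam x a) \<in> borel_measurable PX" if "a \<in> A" for a
    using integrable_score[OF that] by (rule borel_measurable_integrable)
  have meas: "(\<lambda>x. softmax \<beta> A (score M loss c lam x) a) \<in> borel_measurable PX" if "a \<in> A" for a
    unfolding softmax_def using s s[OF that]
    by (intro borel_measurable_divide borel_measurable_sum
        measurable_compose[OF _ borel_measurable_exp] borel_measurable_times) auto
  show "gibbs lam \<in> predictions"
    unfolding gibbs_def using finite_A A_nonempty meas
    by (intro kernel_of_weights) (auto intro: less_imp_le softmax_pos sum_softmax)
  show "x \<in> space PX \<Longrightarrow> a \<in> A \<Longrightarrow>
      pred_prob (gibbs lam) a x = softmax \<beta> A (score M loss c lam x) a"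
    unfolding gibbs_def using finite_A A_nonempty meas
    by (intro kernel_of_weights) (auto intro: less_imp_le softmax_pos sum_softmax)
qed

lemma regularized_gain_gibbs:
  assumes "x \<in> space PX"
  shows "regularized_gain \<beta> A (score M loss c lam x) (\<lambda>a. pred_prob (gibbs lam) a x) =
    LSE \<beta> A (score M loss c lam x)"
  using assms regularized_gain_softmax[OF finite_A A_nonempty beta_pos]
  by (simp add: pred_prob_gibbs regularized_gain_def)

lemma lagrangian_gibbs: "lagrangian (gibbs lam) lam = - dual_value lam"
  unfolding lagrangian_eq_integral[OF gibbs_predictions] dual_objective_def
  using regularized_gain_gibbs by (auto intro: Bochner_Integration.integral_cong)

lemma integrable_LSE: "integrable PX (\<lambda>x. LSE \<beta> A (score M loss c lam x))"
proof -
  have "integrable PX (\<lambda>x. regularized_gain \<beta> A (score M loss c lam x)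
      (\<lambda>a. pred_prob (gibbs lam) a x))"
    using gibbs_predictions by (rule integrable_regularized_gain)
  then show ?thesis
    by (rule Bochner_Integration.integrable_cong[THEN iffD1, rotated -1])
      (simp_all add: regularized_gain_gibbs)
qed

lemma weak_duality:
  assumes \<pi>: "\<pi> \<in> predictions"
  shows "- dual_value lam \<le> lagrangian \<pi> lam"
proof -
  have "(\<integral>x. regularized_gain \<beta> A (score M loss c lam x) (\<lambda>a. pred_prob \<pi> a x) \<partial>PX)
      \<le> dual_value lam"
    unfolding dual_objective_def
    using randomized_predictionsD[OF \<pi> finite_A] finite_A A_nonempty beta_pos
    by (intro integral_mono integrable_regularized_gain[OF \<pi>] integrable_LSE
        regularized_gain_le_LSE) auto
  then show ?thesis by (simp add: lagrangian_eq_integral[OF \<pi>])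
qed

text \<open>
  The kernel \<open>gibbs mu\<close> is optimal for the multiplier \<open>mu\<close> and merely admissible for \<open>lam\<close>, and
  the two Lagrangians of this one kernel differ by a linear function of the multipliers.  The
  inequality says that the costs of \<open>gibbs mu\<close>, with the opposite sign, form a subgradient of the
  dual objective at \<open>mu\<close>.
\<close>

lemma dual_value_diff_le:
  "dual_value mu - dual_value lam \<le> (\<Sum>j\<in>{1..M}. (lam j - mu j) * cost j (gibbs mu))"
  using weak_duality[OF gibbs_predictions, of lam mu] lagrangian_gibbs[of mu]
  by (simp add: lagrangian_def left_diff_distrib sum_subtractf)

section \<open>Existence of a dual solution\<close>

definition cost_bound :: real where
  "cost_bound = (\<Sum>j\<in>{1..M}. \<integral>x. (\<Sum>a\<in>A. \<bar>c j x a\<bar>) \<partial>PX)"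

lemma abs_cost_le:
  assumes \<pi>: "\<pi> \<in> predictions" and j: "j \<in> {1..M}"
  shows "\<bar>cost j \<pi>\<bar> \<le> cost_bound"
proof -
  note p = randomized_predictionsD[OF \<pi> finite_A]
  have "\<bar>cost j \<pi>\<bar> \<le> (\<integral>x. \<bar>\<Sum>a\<in>A. c j x a * pred_prob \<pi> a x\<bar> \<partial>PX)"
    unfolding mean_value_def by (rule integral_abs_bound)
  also have "\<dots> \<le> (\<integral>x. (\<Sum>a\<in>A. \<bar>c j x a\<bar>) \<partial>PX)"
    using integrable_cost[OF j] p
    by (intro integral_mono integrable_abs integrable_mean[OF \<pi>] Bochner_Integration.integrable_sum
        order.trans[OF sum_abs] sum_mono) (auto simp: abs_mult mult_left_le)
  also have "\<dots> \<le> cost_bound"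
    unfolding cost_bound_def using j
    by (intro member_le_sum) (auto intro!: Bochner_Integration.integral_nonneg sum_nonneg)
  finally show ?thesis .
qed

lemma dual_value_Lipschitz:
  "\<bar>dual_value mu - dual_value lam\<bar> \<le> cost_bound * (\<Sum>j\<in>{1..M}. \<bar>mu j - lam j\<bar>)"
proof -
  have *: "dual_value mu - dual_value lam \<le> cost_bound * (\<Sum>j\<in>{1..M}. \<bar>mu j - lam j\<bar>)" for mu lam
  proof -
    have "(\<Sum>j\<in>{1..M}. (lam j - mu j) * cost j (gibbs mu)) \<le>
        (\<Sum>j\<in>{1..M}. cost_bound * \<bar>mu j - lam j\<bar>)"
    proof (rule sum_mono)
      fix j assume j: "j \<in> {1..M}"
      have "(lam j - mu j) * cost j (gibbs mu) \<le> \<bar>lam j - mu j\<bar> * \<bar>cost j (gibbs mu)\<bar>"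
        by (metis abs_ge_self abs_mult)
      also have "\<dots> \<le> \<bar>lam j - mu j\<bar> * cost_bound"
        using abs_cost_le[OF gibbs_predictions j] by (intro mult_left_mono) auto
      finally show "(lam j - mu j) * cost j (gibbs mu) \<le> cost_bound * \<bar>mu j - lam j\<bar>"
        by (simp add: mult.commute abs_minus_commute)
    qed
    then show ?thesis using dual_value_diff_le[of mu lam] by (simp add: sum_distrib_left)
  qed
  show ?thesis using *[of mu lam] *[of lam mu] by (simp add: abs_minus_commute)
qed

lemma continuous_on_dual_value: "continuous_on S dual_value"
  unfolding continuous_on_def
proof
  fix lam assume "lam \<in> S"
  have coord: "((\<lambda>mu. mu j) \<longlongrightarrow> lam j) (at lam within S)" for j
    using continuous_on_subset[OF continuous_on_product_coordinates[of j] subset_UNIV, of S]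
      \<open>lam \<in> S\<close> by (auto simp: continuous_on_def)
  have "((\<lambda>mu. cost_bound * (\<Sum>j\<in>{1..M}. \<bar>mu j - lam j\<bar>)) \<longlongrightarrow>
      cost_bound * (\<Sum>j\<in>{1..M}. \<bar>lam j - lam j\<bar>)) (at lam within S)"
    by (intro tendsto_intros coord)
  then have lim: "((\<lambda>mu. cost_bound * (\<Sum>j\<in>{1..M}. \<bar>mu j - lam j\<bar>)) \<longlongrightarrow> 0) (at lam within S)"
    by simp
  have "((\<lambda>mu. dual_value mu - dual_value lam) \<longlongrightarrow> 0) (at lam within S)"
  proof (rule Lim_null_comparison[OF _ lim], rule always_eventually, rule allI)
    fix mu
    show "norm (dual_value mu - dual_value lam) \<le> cost_bound * (\<Sum>j\<in>{1..M}. \<bar>mu j - lam j\<bar>)"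
      unfolding real_norm_def by (rule dual_value_Lipschitz)
  qed
  then show "(dual_value \<longlongrightarrow> dual_value lam) (at lam within S)" by (simp add: LIM_zero_iff)
qed

text \<open>Weak duality at a strictly feasible kernel, whose costs are all at most some \<open>- \<delta> < 0\<close>.\<close>

lemma dual_value_coercive:
  assumes \<pi>: "\<pi> \<in> predictions" and slater: "\<And>j. j \<in> {1..M} \<Longrightarrow> cost j \<pi> < 0"
  obtains \<delta> where "\<delta> > 0"
    and "\<forall>lam\<in>orthant. \<delta> * (\<Sum>j\<in>{1..M}. lam j) - risk \<pi> \<le> dual_value lam"
proof
  \<comment> \<open>The element 1 keeps the set nonempty when there are no constraints.\<close>
  define \<delta> where "\<delta> = Min (insert 1 ((\<lambda>j. - cost j \<pi>) ` {1..M}))"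
  show "\<delta> > 0" unfolding \<delta>_def using slater by (subst Min_gr_iff) auto
  show "\<forall>lam\<in>orthant. \<delta> * (\<Sum>j\<in>{1..M}. lam j) - risk \<pi> \<le> dual_value lam"
  proof
    fix lam assume lam: "lam \<in> orthant"
    have "lam j * cost j \<pi> \<le> - (\<delta> * lam j)" if j: "j \<in> {1..M}" for j
    proof -
      have "\<delta> \<le> - cost j \<pi>" unfolding \<delta>_def using j by (intro Min_le) auto
      moreover have "0 \<le> lam j" using lam j by auto
      ultimately have "lam j * \<delta> \<le> lam j * (- cost j \<pi>)" by (intro mult_left_mono)
      then show ?thesis by (simp add: mult.commute)
    qed
    then have "(\<Sum>j\<in>{1..M}. lam j * cost j \<pi>) \<le> (\<Sum>j\<in>{1..M}. - (\<delta> * lam j))" by (rule sum_mono)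
    then show "\<delta> * (\<Sum>j\<in>{1..M}. lam j) - risk \<pi> \<le> dual_value lam"
      using weak_duality[OF \<pi>, of lam] by (simp add: lagrangian_def sum_negf sum_distrib_left)
  qed
qed

lemma dual_solution_exists:
  assumes \<pi>: "\<pi> \<in> predictions" and slater: "\<And>j. j \<in> {1..M} \<Longrightarrow> cost j \<pi> < 0"
  shows "\<exists>lam. dual_solution PX A M loss c \<beta> lam"
proof -
  obtain \<delta> where \<delta>: "\<delta> > 0"
    and coercive: "\<forall>lam\<in>orthant. \<delta> * (\<Sum>j\<in>{1..M}. lam j) - risk \<pi> \<le> dual_value lam"
    by (rule dual_value_coercive[OF assms])
  define origin :: "nat \<Rightarrow> real" where "origin = (\<lambda>j\<in>{1..M}. 0)"
  \<comment> \<open>Outside the box of side \<open>K\<close> the dual objective is at least its value at the origin.\<close>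
  define K where "K = max 0 ((dual_value origin + risk \<pi>) / \<delta>)"
  define box :: "(nat \<Rightarrow> real) set" where
    "box = PiE UNIV (\<lambda>j. if j \<in> {1..M} then {0..K} else {undefined})"
  have "compact box"
  proof -
    have "compactin (product_topology (\<lambda>_. euclidean) UNIV) box"
      unfolding box_def by (subst compactin_PiE) auto
    then show ?thesis by (simp add: euclidean_product_topology)
  qed
  moreover have origin: "origin \<in> box" by (auto simp: origin_def box_def K_def)
  ultimately obtain lam where lam: "lam \<in> box"
    and min: "\<And>mu. mu \<in> box \<Longrightarrow> dual_value lam \<le> dual_value mu"
    using continuous_attains_inf[OF _ _ continuous_on_dual_value[of box]] by blast
  have "dual_value lam \<le> dual_value mu" if mu: "mu \<in> orthant" for mu
  proof (cases "mu \<in> box")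
    case False
    then obtain k where "mu k \<notin> (if k \<in> {1..M} then {0..K} else {undefined})"
      by (auto simp: box_def PiE_iff)
    then have k: "k \<in> {1..M}" "mu k > K"
      using mu by (auto simp: PiE_iff extensional_def split: if_splits)
    have "mu k \<le> (\<Sum>j\<in>{1..M}. mu j)" using k mu by (intro member_le_sum) auto
    then have "\<delta> * K \<le> \<delta> * (\<Sum>j\<in>{1..M}. mu j)" using k \<delta> by (intro mult_left_mono) auto
    moreover have "dual_value origin + risk \<pi> \<le> \<delta> * K"
      using \<delta> by (simp add: K_def max_def field_simps)
    ultimately have "dual_value origin \<le> dual_value mu" using coercive mu by fastforce
    then show ?thesis using min[OF origin] by simp
  qed (rule min)
  moreover have "lam \<in> orthant"
    using lam by (auto simp: box_def PiE_iff extensional_def split: if_splits)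
  ultimately show ?thesis by (auto simp: dual_solution_def is_arg_min_def not_less)
qed

section \<open>Optimality of the Gibbs kernel\<close>

lemma softmax_tendsto:
  assumes "\<And>i. i \<in> insert k A \<Longrightarrow> (\<lambda>n. w n i) \<longlonglongrightarrow> v i"
  shows "(\<lambda>n. softmax \<beta> A (w n) k) \<longlonglongrightarrow> softmax \<beta> A v k"
  unfolding softmax_def using assms sum_exp_pos[OF finite_A A_nonempty, of \<beta> v]
  by (intro tendsto_intros) auto

text \<open>Dominated convergence, the absolute costs serving as the bound.\<close>

lemma cost_gibbs_tendsto:
  assumes j: "j \<in> {1..M}" and mu: "\<And>i. i \<in> {1..M} \<Longrightarrow> (\<lambda>n. mu n i) \<longlonglongrightarrow> lam i"
  shows "(\<lambda>n. cost j (gibbs (mu n))) \<longlonglongrightarrow> cost j (gibbs lam)"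
  unfolding mean_value_def
proof (rule integral_dominated_convergence[where w = "\<lambda>x. \<Sum>a\<in>A. \<bar>c j x a\<bar>"])
  show "integrable PX (\<lambda>x. \<Sum>a\<in>A. \<bar>c j x a\<bar>)" using integrable_cost[OF j] by auto
  have "(\<lambda>n. \<Sum>a\<in>A. c j x a * pred_prob (gibbs (mu n)) a x) \<longlonglongrightarrow>
      (\<Sum>a\<in>A. c j x a * pred_prob (gibbs lam) a x)" if x: "x \<in> space PX" for x
  proof -
    have "(\<lambda>n. pred_prob (gibbs (mu n)) a x) \<longlonglongrightarrow> pred_prob (gibbs lam) a x" if "a \<in> A" for a
      unfolding pred_prob_gibbs[OF x that] score_def
      by (intro softmax_tendsto tendsto_intros mu)
    then show ?thesis by (intro tendsto_intros)
  qed
  then show "AE x in PX. (\<lambda>n. \<Sum>a\<in>A. c j x a * pred_prob (gibbs (mu n)) a x) \<longlonglongrightarrow>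
      (\<Sum>a\<in>A. c j x a * pred_prob (gibbs lam) a x)"
    by (intro AE_I2)
  show "(\<lambda>x. \<Sum>a\<in>A. c j x a * pred_prob (gibbs lam) a x) \<in> borel_measurable PX"
    using integrable_mean[OF gibbs_predictions integrable_cost[OF j]]
    by (rule borel_measurable_integrable)
  fix n
  note p = randomized_predictionsD[OF gibbs_predictions finite_A]
  show "(\<lambda>x. \<Sum>a\<in>A. c j x a * pred_prob (gibbs (mu n)) a x) \<in> borel_measurable PX"
    using integrable_mean[OF gibbs_predictions integrable_cost[OF j]]
    by (rule borel_measurable_integrable)
  show "AE x in PX. norm (\<Sum>a\<in>A. c j x a * pred_prob (gibbs (mu n)) a x) \<le> (\<Sum>a\<in>A. \<bar>c j x a\<bar>)"
    using p unfolding real_norm_def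
    by (intro AE_I2 order.trans[OF sum_abs] sum_mono) (auto simp: abs_mult mult_left_le)
qed

text \<open>
  First-order optimality in the direction \<open>d\<close> along coordinate \<open>j\<close>: by the subgradient inequality
  the costs of the Gibbs kernels along the segment have a sign, and this sign passes to the limit.
\<close>

lemma dual_solution_first_order:
  assumes lam: "dual_solution PX A M loss c \<beta> lam" and j: "j \<in> {1..M}" and d: "0 \<le> lam j + d"
  shows "d * cost j (gibbs lam) \<le> 0"
proof -
  define t :: "nat \<Rightarrow> real" where "t n = inverse (real (Suc n))" for n
  define mu where "mu n = lam(j := lam j + t n * d)" for n
  have t: "0 < t n" "t n \<le> 1" for n by (auto simp: t_def field_simps)
  have lam_orthant: "lam \<in> orthant" and min: "\<And>mu. mu \<in> orthant \<Longrightarrow> dual_value lam \<le> dual_value mu"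
    using lam by (auto simp: dual_solution_def is_arg_min_def not_less)
  then have lam_j: "0 \<le> lam j" using j by auto
  have "d * cost j (gibbs (mu n)) \<le> 0" for n
  proof -
    have "0 \<le> (1 - t n) * lam j + t n * (lam j + d)"
      using t(1)[of n] t(2)[of n] lam_j d
      by (simp add: mult_nonneg_nonneg add_nonneg_nonneg)
    then have "0 \<le> lam j + t n * d" by (simp add: algebra_simps)
    then have "mu n \<in> orthant"
      using lam_orthant j by (auto simp: mu_def PiE_iff extensional_def)
    then have "0 \<le> dual_value (mu n) - dual_value lam" using min by simp
    also have "\<dots> \<le> (\<Sum>i\<in>{1..M}. (lam i - mu n i) * cost i (gibbs (mu n)))"
      by (rule dual_value_diff_le)
    also have "\<dots> = (\<Sum>i\<in>{1..M}. if i = j then - t n * d * cost j (gibbs (mu n)) else 0)"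
      by (intro sum.cong) (auto simp: mu_def)
    also have "\<dots> = - t n * (d * cost j (gibbs (mu n)))" using j by simp
    finally show ?thesis using t(1)[of n] by (simp add: mult_le_0_iff zero_le_mult_iff)
  qed
  moreover have "(\<lambda>n. cost j (gibbs (mu n))) \<longlonglongrightarrow> cost j (gibbs lam)"
  proof (rule cost_gibbs_tendsto[OF j])
    have "t \<longlonglongrightarrow> 0" unfolding t_def by (rule LIMSEQ_inverse_real_of_nat)
    then have "(\<lambda>n. lam j + t n * d) \<longlonglongrightarrow> lam j + 0 * d" by (intro tendsto_intros)
    then show "(\<lambda>n. mu n i) \<longlonglongrightarrow> lam i" for i by (cases "i = j") (auto simp: mu_def)
  qed
  ultimately show ?thesis
    by (intro LIMSEQ_le_const2[where X = "\<lambda>n. d * cost j (gibbs (mu n))"] tendsto_mult) auto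
qed

lemma dual_solution_feasible:
  assumes lam: "dual_solution PX A M loss c \<beta> lam" and j: "j \<in> {1..M}"
  shows "cost j (gibbs lam) \<le> 0"
proof -
  have "0 \<le> lam j" using lam j by (auto simp: dual_solution_def is_arg_min_def)
  then show ?thesis using dual_solution_first_order[OF lam j, of 1] by simp
qed

text \<open>Moving the \<open>j\<close>-th multiplier all the way to 0 is an admissible direction.\<close>

lemma dual_solution_complementary:
  assumes lam: "dual_solution PX A M loss c \<beta> lam" and j: "j \<in> {1..M}"
  shows "lam j * cost j (gibbs lam) = 0"
proof (rule antisym)
  have "0 \<le> lam j" using lam j by (auto simp: dual_solution_def is_arg_min_def)
  then show "lam j * cost j (gibbs lam) \<le> 0"
    using dual_solution_feasible[OF lam j] by (rule mult_nonneg_nonpos)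
  show "0 \<le> lam j * cost j (gibbs lam)"
    using dual_solution_first_order[OF lam j, of "- lam j"] by simp
qed

lemma gibbs_primal_solution:
  assumes lam: "dual_solution PX A M loss c \<beta> lam"
  shows "primal_solution PX A M loss c \<beta> (gibbs lam)"
proof -
  have "risk (gibbs lam) \<le> risk \<pi>"
    if \<pi>: "\<pi> \<in> predictions" and feas: "\<forall>j\<in>{1..M}. cost j \<pi> \<le> 0" for \<pi>
  proof -
    have "(\<Sum>j\<in>{1..M}. lam j * cost j (gibbs lam)) = 0"
      by (intro sum.neutral ballI dual_solution_complementary[OF lam])
    then have "risk (gibbs lam) = lagrangian (gibbs lam) lam"
      by (simp add: lagrangian_def)
    also have "\<dots> \<le> lagrangian \<pi> lam" using weak_duality[OF \<pi>] by (simp add: lagrangian_gibbs)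
    also have "\<dots> \<le> risk \<pi>"
    proof -
      have "0 \<le> lam j" if "j \<in> {1..M}" for j
        using lam that by (auto simp: dual_solution_def is_arg_min_def)
      then show ?thesis
        using feas by (auto simp: lagrangian_def intro!: sum_nonpos mult_nonneg_nonpos)
    qed
    finally show ?thesis .
  qed
  then show ?thesis
    using gibbs_predictions dual_solution_feasible[OF lam]
    unfolding primal_solution_def is_arg_min_def by (meson not_less)
qed

end

section \<open>Strong duality\<close>

theorem lemma3p1:
  fixes PX :: "'x measure" and A :: "'a set" and M :: nat
    and loss :: "'x \<Rightarrow> 'a \<Rightarrow> real" and c :: "nat \<Rightarrow> 'x \<Rightarrow> 'a \<Rightarrow> real" and \<beta> :: real
  assumes "prob_space PX"
    and "finite A"
    and "(\<lambda>(x, a). loss x a) \<in> borel_measurable (PX \<Otimes>\<^sub>M count_space A)"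
    and "\<And>j. j \<in> {1..M} \<Longrightarrow> (\<lambda>(x, a). c j x a) \<in> borel_measurable (PX \<Otimes>\<^sub>M count_space A)"
    and "integrable PX (\<lambda>x. L2_set (loss x) A)"
    and "integrable PX (\<lambda>x. op_norm_2_2 M A (\<lambda>j a. c j x a))"
    and "\<beta> > 0"
    and "\<exists>\<pi>\<in>randomized_predictions PX A. \<forall>j\<in>{1..M}. mean_value PX A (c j) \<pi> < 0"
  shows "(\<exists>lam. dual_solution PX A M loss c \<beta> lam) \<and>
    (\<forall>lam. dual_solution PX A M loss c \<beta> lam \<longrightarrow>
      (\<exists>\<pi>. primal_solution PX A M loss c \<beta> \<pi> \<and>
        (\<forall>x\<in>space PX. \<forall>a\<in>A. pred_prob \<pi> a x =
           exp (\<beta> * score M loss c lam x a) / (\<Sum>b\<in>A. exp (\<beta> * score M loss c lam x b)))))"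
proof -
  interpret prob_space PX by fact
  obtain \<pi> where \<pi>: "\<pi> \<in> randomized_predictions PX A"
    and slater: "\<And>j. j \<in> {1..M} \<Longrightarrow> mean_value PX A (c j) \<pi> < 0"
    using assms(8) by blast
  have "A \<noteq> {}"
    using randomized_predictionsD(4)[OF \<pi> \<open>finite A\<close>] not_empty by auto
  have slice: "(\<lambda>x. g x a) \<in> borel_measurable PX"
    if "(\<lambda>(x, a). g x a) \<in> borel_measurable (PX \<Otimes>\<^sub>M count_space A)" "a \<in> A"
    for g :: "'x \<Rightarrow> 'a \<Rightarrow> real" and a
    using measurable_Pair1[OF that(1), of a] that(2) by simp
  have loss: "integrable PX (\<lambda>x. loss x a)" if a: "a \<in> A" for a
  proof (rule Bochner_Integration.integrable_bound[OF assms(5)])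
    show "(\<lambda>x. loss x a) \<in> borel_measurable PX" using assms(3) a by (rule slice)
    have "\<bar>loss x a\<bar> \<le> L2_set (\<lambda>a. \<bar>loss x a\<bar>) A" for x
      using \<open>finite A\<close> a by (intro member_le_L2_set)
    then show "AE x in PX. norm (loss x a) \<le> norm (L2_set (loss x) A)"
      by (intro AE_I2) (simp add: L2_set_def order.trans[OF _ abs_ge_self])
  qed
  have cost: "integrable PX (\<lambda>x. c j x a)" if j: "j \<in> {1..M}" and a: "a \<in> A" for j a
  proof (rule Bochner_Integration.integrable_bound[OF assms(6)])
    show "(\<lambda>x. c j x a) \<in> borel_measurable PX" using assms(4)[OF j] a by (rule slice)
    have "\<bar>c j x a\<bar> \<le> op_norm_2_2 M A (\<lambda>j a. c j x a)" for x
      using abs_entry_le_op_norm_2_2[OF \<open>finite A\<close> a j, of "\<lambda>j a. c j x a"] .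
    then show "AE x in PX. norm (c j x a) \<le> norm (op_norm_2_2 M A (\<lambda>j a. c j x a))"
      by (intro AE_I2) (simp add: order.trans[OF _ abs_ge_self])
  qed
  interpret entropic_problem PX A M loss c \<beta>
    using \<open>finite A\<close> \<open>A \<noteq> {}\<close> \<open>\<beta> > 0\<close> loss cost by unfold_locales
  show ?thesis
  proof (intro conjI allI impI)
    show "\<exists>lam. dual_solution PX A M loss c \<beta> lam"
      using \<pi> slater by (rule dual_solution_exists)
    fix lam assume "dual_solution PX A M loss c \<beta> lam"
    then show "\<exists>\<pi>. primal_solution PX A M loss c \<beta> \<pi> \<and>
        (\<forall>x\<in>space PX. \<forall>a\<in>A. pred_prob \<pi> a x =
           exp (\<beta> * score M loss c lam x a) / (\<Sum>b\<in>A. exp (\<beta> * score M loss c lam x b)))"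
      by (intro exI[of _ "gibbs lam"] conjI gibbs_primal_solution)
        (simp_all add: pred_prob_gibbs softmax_def)
  qed
qed

end
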